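(* Let $X\sim N_p(\mu,\sigma_X^2 I_p)$ and $Y\sim N_p(\mu,\sigma_Y^2 I_p)$ be independent, with $\sigma_X^2,\sigma_Y^2>0$ known and $\mu\in\mathbb{R}^p$ unknown. For estimating the density of $Y$ based on $X$ under integrated $L_2$ loss, the predictive density estimator $\hat q_{\rm mre}(\cdot;X)$ given by the $N_p(X,(\sigma_X^2+\sigma_Y^2)I_p)$ density is inadmissible for $p\ge 3$, and it is dominated by any estimator $\hat q(\cdot;X)$ given by the $N_p(\hat\mu(X),(\sigma_X^2+\sigma_Y^2)I_p)$ density, where $\hat\mu:\mathbb{R}^p\to\mathbb{R}^p$ is such that $\hat\mu(Z)$ dominates $Z$ as an estimator of $\mu$ for $Z\sim N_p(\mu,\sigma_Z^2 I_p)$ under loss $\|\hat\mu-\mu\|^2$, with $$\sigma_Z^2=\frac{(2\sigma_Y^2+\sigma_X^2)\,\sigma_X^2}{2(\sigma_Y^2+\sigma_X^2)}.$$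
   Context: For the true density $q(\cdot-\mu)$ of $Y$ and a predictive density estimate $\hat q(\cdot;x)$, the integrated $L_2$ loss is $\int_{\mathbb{R}^p}(q(y-\mu)-\hat q(y;x))^2\,dy$, and the frequentist risk $R(\mu,\hat q)$ is its expectation over $X$. An estimator dominates another if its risk is less than or equal to the other's for all $\mu$, with strict inequality for at least one $\mu$ (same definition for point estimators under a given point estimation loss). An estimator is inadmissible if some estimator dominates it. *)

theory Defs
  imports "HOL-Probability.Probability"
begin

text \<open>Parametrised by the variance \<open>v\<close>, not the standard deviation:
  the density of $N_p(m, v I_p)$ with $p$ the cardinality of \<open>'n\<close>.\<close>

definition mvn_density :: "real^'n \<Rightarrow> real \<Rightarrow> real^'n \<Rightarrow> real" where
  "mvn_density m v y =
     exp (- (norm (y - m))\<^sup>2 / (2 * v)) / sqrt (2 * pi * v) ^ CARD('n)"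

lemma mvn_density_eq_prod:
  fixes m y :: "real^'n"
  assumes "v > 0"
  shows "mvn_density m v y = (\<Prod>i\<in>UNIV. normal_density (m $ i) (sqrt v) (y $ i))"
proof -
  have "(norm (y - m))\<^sup>2 = (\<Sum>i\<in>UNIV. (y $ i - m $ i)\<^sup>2)"
    by (simp add: norm_vec_def L2_set_def sum_nonneg)
  then show ?thesis
    using assms
    by (simp add: mvn_density_def normal_density_def prod_dividef prod.distrib
        exp_sum[symmetric] sum_divide_distrib sum_negf)
qed

definition mvn_measure :: "real^'n \<Rightarrow> real \<Rightarrow> (real^'n) measure" where
  "mvn_measure m v = density lborel (\<lambda>y. ennreal (mvn_density m v y))"

text \<open>Here \<open>P \<theta>\<close> is the law of the observation under the parameter \<open>\<theta>\<close>.
  Losses and risks take values in \<open>[0, \<infinity>]\<close>, so that an estimator whose expected loss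
  diverges has risk \<open>\<infinity>\<close> rather than the value 0 of an undefined Bochner integral.
  The set \<open>E\<close> is the class of all estimators.\<close>

definition risk ::
  "('t \<Rightarrow> 'x measure) \<Rightarrow> ('t \<Rightarrow> 'd \<Rightarrow> ennreal) \<Rightarrow> 't \<Rightarrow> ('x \<Rightarrow> 'd) \<Rightarrow> ennreal" where
  "risk P L \<theta> \<delta> = (\<integral>\<^sup>+ x. L \<theta> (\<delta> x) \<partial>P \<theta>)"

definition dominates ::
  "('x \<Rightarrow> 'd) set \<Rightarrow> ('t \<Rightarrow> 'x measure) \<Rightarrow> ('t \<Rightarrow> 'd \<Rightarrow> ennreal) \<Rightarrow>
     ('x \<Rightarrow> 'd) \<Rightarrow> ('x \<Rightarrow> 'd) \<Rightarrow> bool" where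
  "dominates E P L \<delta>' \<delta> \<longleftrightarrow>
     \<delta>' \<in> E \<and> \<delta> \<in> E \<and>
     (\<forall>\<theta>. risk P L \<theta> \<delta>' \<le> risk P L \<theta> \<delta>) \<and>
     (\<exists>\<theta>. risk P L \<theta> \<delta>' < risk P L \<theta> \<delta>)"

definition inadmissible ::
  "('x \<Rightarrow> 'd) set \<Rightarrow> ('t \<Rightarrow> 'x measure) \<Rightarrow> ('t \<Rightarrow> 'd \<Rightarrow> ennreal) \<Rightarrow>
     ('x \<Rightarrow> 'd) \<Rightarrow> bool" where
  "inadmissible E P L \<delta> \<longleftrightarrow> (\<exists>\<delta>'. dominates E P L \<delta>' \<delta>)"

definition point_estimators :: "(real^'n \<Rightarrow> real^'n) set" where
  "point_estimators = borel_measurable borel"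

definition squared_error_loss :: "real^'n \<Rightarrow> real^'n \<Rightarrow> ennreal" where
  "squared_error_loss \<mu> d = ennreal ((norm (d - \<mu>))\<^sup>2)"

text \<open>A predictive density estimator is curried: \<open>qhat x y\<close> stands for $\hat q(y;x)$.\<close>

definition density_estimators :: "(real^'n \<Rightarrow> real^'n \<Rightarrow> real) set" where
  "density_estimators =
     {qhat. (\<lambda>(x, y). qhat x y) \<in> borel_measurable (borel \<Otimes>\<^sub>M borel) \<and>
            (\<forall>x y. 0 \<le> qhat x y) \<and>
            (\<forall>x. (\<integral>\<^sup>+ y. ennreal (qhat x y) \<partial>lborel) = 1)}"

definition integrated_L2_loss ::
  "(real^'n \<Rightarrow> real) \<Rightarrow> real^'n \<Rightarrow> (real^'n \<Rightarrow> real) \<Rightarrow> ennreal" where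
  "integrated_L2_loss q \<mu> d = (\<integral>\<^sup>+ y. ennreal ((q (y - \<mu>) - d y)\<^sup>2) \<partial>lborel)"

end

theory Submission
  imports Defs
begin

text \<open>
  The loss of the estimate with mean \<open>m\<close> and variance \<open>\<sigma>X\<^sup>2 + \<sigma>Y\<^sup>2\<close> depends on \<open>m\<close> and \<open>\<mu>\<close> only
  through their distance (\<open>L2_loss_mvn_density\<close>): up to an additive constant it is \<open>-2\<close> times the
  Gaussian density of variance \<open>w = 2 \<sigma>Y\<^sup>2 + \<sigma>X\<^sup>2\<close> and mean \<open>\<mu>\<close>, taken at \<open>m\<close>. This is a concave
  function of the squared distance, so replacing \<open>x\<close> by \<open>\<mu>hat x\<close> reduces the loss at least by the
  amount that the tangent at \<open>\<parallel>x - \<mu>\<parallel>\<^sup>2\<close> predicts, namely the reduction of the squared error,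
  weighted by the slope of the tangent. That slope is proportional to the Gaussian density of
  variance \<open>w\<close> at \<open>x\<close>; multiplied by the density of \<open>X\<close> it is proportional to the Gaussian density
  of variance \<open>\<sigma>X\<^sup>2 w / (\<sigma>X\<^sup>2 + w)\<close>, which is the variance of \<open>Z\<close>. Hence the reduction of the
  \<open>L\<^sub>2\<close> risk is at least a positive multiple of the reduction of the quadratic risk for \<open>Z\<close>
  (\<open>gaussian_gain_ge_quadratic_gain\<close>), and domination is transferred, strictness included.

  Inadmissibility in dimension at least \<open>3\<close> then only needs one point estimator that dominates
  \<open>Z\<close>, which is Stein's phenomenon. It is proved for \<open>z - a z / (1 + \<parallel>z\<parallel>\<^sup>2)\<close> with a suitable
  \<open>a > 0\<close> (\<open>james_stein_gain\<close>): this shrinkage is smooth and bounded, so that Stein's identity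
  follows from the fundamental theorem of calculus and the translation invariance of Lebesgue
  measure (\<open>integral_directional_derivative_eq_0\<close>).
\<close>

section \<open>Gaussian measures and their second moments\<close>

lemma mvn_density_pos: "v > 0 \<Longrightarrow> 0 < mvn_density m v y"
  by (simp add: mvn_density_def)

lemma mvn_density_nonneg: "v > 0 \<Longrightarrow> 0 \<le> mvn_density m v y"
  by (simp add: mvn_density_def)

lemma mvn_density_shift: "mvn_density 0 v (y - m) = mvn_density m v y"
  by (simp add: mvn_density_def)

lemma mvn_density_self: "mvn_density m v m = mvn_density (0 :: real^'n) v 0"
  for m :: "real^'n"
  by (simp add: mvn_density_def)

lemma mvn_density_le_self: "v > 0 \<Longrightarrow> mvn_density m v y \<le> mvn_density (0 :: real^'n) v 0"
  for m :: "real^'n"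
  by (simp add: mvn_density_def divide_right_mono)

lemma measurable_mvn_density [measurable]:
  assumes [measurable]: "f \<in> borel_measurable M" "g \<in> borel_measurable M"
  shows "(\<lambda>x. mvn_density (f x) v (g x)) \<in> borel_measurable M"
  unfolding mvn_density_def by measurable

lemma nn_integral_mvn_density:
  fixes m :: "real^'n"
  assumes "v > 0"
  shows "(\<integral>\<^sup>+ y. ennreal (mvn_density m v y) \<partial>lborel) = 1"
proof -
  have prod: "mvn_density m v y
      = (\<Prod>b\<in>Basis. normal_density (m \<bullet> b) (sqrt v) (y \<bullet> b))" for y
  proof -
    have "(norm (y - m))\<^sup>2 = (\<Sum>b\<in>Basis. (y \<bullet> b - m \<bullet> b)\<^sup>2)"
      unfolding power2_norm_eq_inner euclidean_inner[of "y - m" "y - m"]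
      by (simp add: power2_eq_square inner_diff_left)
    then show ?thesis
      using assms
      by (simp add: mvn_density_def normal_density_def prod_dividef prod.distrib
          exp_sum[symmetric] sum_divide_distrib sum_negf)
  qed
  have "(\<integral>\<^sup>+ y. ennreal (mvn_density m v y) \<partial>lborel)
      = (\<integral>\<^sup>+ y. (\<Prod>b\<in>Basis. ennreal (normal_density (m \<bullet> b) (sqrt v) (y \<bullet> b))) \<partial>lborel)"
    unfolding prod by (subst prod_ennreal) auto
  also have "\<dots> = (\<Prod>b\<in>Basis. \<integral>\<^sup>+ t. ennreal (normal_density (m \<bullet> b) (sqrt v) t) \<partial>lborel)"
    by (subst nn_integral_lborel_prod[where f = "\<lambda>b t. ennreal (normal_density (m \<bullet> b) (sqrt v) t)"]) auto
  also have "\<dots> = 1"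
    using assms by (subst nn_integral_eq_integral) auto
  finally show ?thesis .
qed

lemma has_integral_mvn_density:
  assumes "v > 0"
  shows "has_bochner_integral lborel (mvn_density m v) 1"
  using nn_integral_mvn_density[OF assms, of m] mvn_density_nonneg[OF assms]
  by (intro has_bochner_integral_nn_integral) auto

lemma prob_space_mvn_measure: "v > 0 \<Longrightarrow> prob_space (mvn_measure m v)"
  by (intro prob_spaceI) (simp add: mvn_measure_def emeasure_density nn_integral_mvn_density)

lemma sets_mvn_measure [simp, measurable_cong]: "sets (mvn_measure m v) = sets borel"
  by (simp add: mvn_measure_def)

lemma space_mvn_measure [simp]: "space (mvn_measure m v) = UNIV"
  by (simp add: mvn_measure_def)

lemma integrable_mvn_measure:
  fixes f :: "real^'n \<Rightarrow> real"
  assumes "v > 0" "f \<in> borel_measurable borel"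
  shows "integrable (mvn_measure m v) f \<longleftrightarrow> integrable lborel (\<lambda>x. mvn_density m v x * f x)"
  unfolding mvn_measure_def using assms by (subst integrable_density) (auto simp: mvn_density_nonneg)

lemma integral_mvn_measure:
  fixes f :: "real^'n \<Rightarrow> real"
  assumes "v > 0" "f \<in> borel_measurable borel"
  shows "integral\<^sup>L (mvn_measure m v) f = (LINT x|lborel. mvn_density m v x * f x)"
  unfolding mvn_measure_def using assms by (subst integral_density) (auto simp: mvn_density_nonneg)

text \<open>Half of the exponential decay absorbs the quadratic factor, which leaves a Gaussian of twice the
  variance. Finite second moments follow by comparison.\<close>

lemma square_mvn_density_bound:
  fixes m x :: "real^'n"
  assumes "v > 0"
  shows "mvn_density m v x * (norm (x - m))\<^sup>2 \<le> 4 * v * sqrt 2 ^ CARD('n) * mvn_density m (2 * v) x"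
proof -
  define t where "t = (norm (x - m))\<^sup>2 / (4 * v)"
  have t: "(norm (x - m))\<^sup>2 = 4 * v * t" "t \<ge> 0" using assms by (auto simp: t_def)
  have "t \<le> exp t" using exp_ge_add_one_self[of t] by linarith
  then have "exp (- (2 * t)) * t \<le> exp (- (2 * t)) * exp t" by (intro mult_left_mono) auto
  also have "\<dots> = exp (- t)" by (simp add: exp_add[symmetric])
  finally have "4 * v * (exp (- (2 * t)) * t) / sqrt (2 * pi * v) ^ CARD('n)
      \<le> 4 * v * exp (- t) / sqrt (2 * pi * v) ^ CARD('n)"
    using assms by (intro divide_right_mono mult_left_mono) auto
  moreover have "sqrt (2 * pi * (2 * v)) = sqrt 2 * sqrt (2 * pi * v)"
    by (simp add: real_sqrt_mult[symmetric])
  ultimately show ?thesis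
    using assms by (simp add: mvn_density_def t(1) power_mult_distrib mult_ac)
qed

lemma integrable_square_mvn_measure:
  fixes m :: "real^'n"
  assumes "v > 0"
  shows "integrable (mvn_measure m v) (\<lambda>x. (norm (x - m))\<^sup>2)"
proof -
  have "integrable lborel (\<lambda>x. 4 * v * sqrt 2 ^ CARD('n) * mvn_density m (2 * v) x)"
    using has_integral_mvn_density[of "2 * v" m] assms by (auto simp: has_bochner_integral_iff)
  then have "integrable lborel (\<lambda>x. mvn_density m v x * (norm (x - m))\<^sup>2)"
    by (rule Bochner_Integration.integrable_bound)
      (use assms square_mvn_density_bound[OF assms] in
        \<open>auto simp: mvn_density_nonneg abs_mult\<close>)
  then show ?thesis using assms by (subst integrable_mvn_measure) auto
qed

section \<open>Products of Gaussian densities and the integrated squared loss\<close>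

text \<open>Completing the square: in the exponent, the sum of two weighted squared distances from \<open>y\<close>
  is one weighted squared distance from the precision-weighted mean \<open>m\<close> plus a remainder without
  \<open>y\<close>. With \<open>a = y - m1\<close> and \<open>b = y - m2\<close>, both sides are quadratic forms in \<open>a\<close> and \<open>b\<close>, because
  \<open>m2 - m1 = a - b\<close>, so only the coefficients of \<open>a \<bullet> a\<close>, \<open>a \<bullet> b\<close> and \<open>b \<bullet> b\<close> have to agree.
  This identity serves twice: integrated over \<open>y\<close> it evaluates the loss, and with \<open>m1 = m2\<close> it is
  the change of measure that replaces the observation \<open>X\<close> by \<open>Z\<close>.\<close>

lemma mvn_density_mult:
  fixes m1 m2 y :: "real^'n"
  assumes "v1 > 0" "v2 > 0"
  shows "mvn_density m1 v1 y * mvn_density m2 v2 y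
       = mvn_density m1 (v1 + v2) m2
         * mvn_density ((v2 / (v1 + v2)) *\<^sub>R m1 + (v1 / (v1 + v2)) *\<^sub>R m2) (v1 * v2 / (v1 + v2)) y"
proof -
  let ?w = "v1 + v2"
  let ?m = "(v2 / ?w) *\<^sub>R m1 + (v1 / ?w) *\<^sub>R m2"
  define a b where "a = y - m1" and "b = y - m2"
  have w: "?w > 0" using assms by simp
  have d: "m2 - m1 = a - b" by (simp add: a_def b_def)
  have "(v2 / ?w) *\<^sub>R y + (v1 / ?w) *\<^sub>R y = y"
    using w by (simp add: scaleR_left_distrib[symmetric] add_divide_distrib[symmetric] add.commute)
  then have c: "y - ?m = (v2 / ?w) *\<^sub>R a + (v1 / ?w) *\<^sub>R b"
    by (simp add: a_def b_def algebra_simps)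
  have "(norm a)\<^sup>2 / v1 + (norm b)\<^sup>2 / v2
      = (norm (m2 - m1))\<^sup>2 / ?w + (norm (y - ?m))\<^sup>2 / (v1 * v2 / ?w)"
  proof -
    define A B C where "A = a \<bullet> a" and "B = b \<bullet> b" and "C = a \<bullet> b"
    have n1: "(norm (m2 - m1))\<^sup>2 = A - 2 * C + B"
      unfolding d power2_norm_eq_inner A_def B_def C_def
      by (simp add: inner_diff inner_commute)
    have "(v2 / ?w) *\<^sub>R a + (v1 / ?w) *\<^sub>R b = (1 / ?w) *\<^sub>R (v2 *\<^sub>R a + v1 *\<^sub>R b)"
      by (simp add: scaleR_right_distrib)
    then have n2: "(norm (y - ?m))\<^sup>2 = (v2\<^sup>2 * A + 2 * v1 * v2 * C + v1\<^sup>2 * B) / ?w\<^sup>2"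
      unfolding c power2_norm_eq_inner A_def B_def C_def
      by (simp add: inner_add inner_commute power2_eq_square add_divide_distrib)
    have q: "(Q / W\<^sup>2) / (P / W) = Q / (W * P)" if "W \<noteq> 0" for Q W P :: real
      using that by (simp add: power2_eq_square)
    have r: "D / W + Q / (W * P) = (D * P + Q) / (W * P)" if "W \<noteq> 0" "P \<noteq> 0" for D Q W P :: real
      using that by (simp add: add_divide_distrib)
    have "(A - 2 * C + B) / ?w + ((v2\<^sup>2 * A + 2 * v1 * v2 * C + v1\<^sup>2 * B) / ?w\<^sup>2) / (v1 * v2 / ?w)
        = ((A - 2 * C + B) * (v1 * v2) + (v2\<^sup>2 * A + 2 * v1 * v2 * C + v1\<^sup>2 * B)) / (?w * (v1 * v2))"
      using assms w by (subst q, simp, subst r) simp_all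
    also have "\<dots> = (?w * (v2 * A + v1 * B)) / (?w * (v1 * v2))"
      by (rule arg_cong2[where f = "(/)"]) (simp_all add: power2_eq_square algebra_simps)
    also have "\<dots> = (v2 * A + v1 * B) / (v1 * v2)"
      using w by (subst mult_divide_mult_cancel_left) simp_all
    also have "\<dots> = A / v1 + B / v2"
      using assms by (simp add: add_divide_distrib)
    finally show ?thesis
      unfolding n1 n2 by (simp add: A_def B_def power2_norm_eq_inner)
  qed
  moreover have half: "- p / (2 * v) = - (1 / 2) * (p / v)" for p v :: real
    by simp
  ultimately have E: "- (norm a)\<^sup>2 / (2 * v1) + - (norm b)\<^sup>2 / (2 * v2)
      = - (norm (m2 - m1))\<^sup>2 / (2 * ?w) + - (norm (y - ?m))\<^sup>2 / (2 * (v1 * v2 / ?w))"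
    by (simp only: half distrib_left[symmetric])
  have S: "sqrt (2 * pi * v1) * sqrt (2 * pi * v2)
      = sqrt (2 * pi * ?w) * sqrt (2 * pi * (v1 * v2 / ?w))"
    using w by (simp add: real_sqrt_mult[symmetric])
  have P: "exp r / k ^ n * (exp t / l ^ n) = exp (r + t) / (k * l) ^ n" for r t k l :: real and n
    by (simp add: exp_add power_mult_distrib)
  show ?thesis
    unfolding mvn_density_def P using E S by (simp only: a_def b_def)
qed

corollary mvn_convolution:
  fixes m1 m2 :: "real^'n"
  assumes "v1 > 0" "v2 > 0"
  shows "has_bochner_integral lborel (\<lambda>y. mvn_density m1 v1 y * mvn_density m2 v2 y)
           (mvn_density m1 (v1 + v2) m2)"
proof -
  have "v1 * v2 / (v1 + v2) > 0" using assms by simp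
  then have "has_bochner_integral lborel
      (\<lambda>y. mvn_density m1 (v1 + v2) m2 * mvn_density ((v2 / (v1 + v2)) *\<^sub>R m1 + (v1 / (v1 + v2)) *\<^sub>R m2)
        (v1 * v2 / (v1 + v2)) y) (mvn_density m1 (v1 + v2) m2 * 1)"
    by (intro has_bochner_integral_mult_right has_integral_mvn_density)
  then show ?thesis
    by (simp only: mvn_density_mult[OF assms] mult_1_right)
qed

text \<open>Expanding the square leaves three Gaussian convolutions. The two pure squares do not depend on
  \<open>m\<close> or \<open>\<mu>\<close>, so the loss is a decreasing affine function of the Gaussian bump
  \<open>mvn_density \<mu> (u + v) m\<close> around \<open>\<mu>\<close>. The second claim allows the value of the loss to be moved
  between \<^typ>\<open>ennreal\<close> and \<^typ>\<open>real\<close>.\<close>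

lemma L2_loss_mvn_density:
  fixes \<mu> m :: "real^'n"
  assumes "u > 0" "v > 0"
  defines "l \<equiv> mvn_density 0 (2 * u) (0 :: real^'n) + mvn_density 0 (2 * v) (0 :: real^'n)
                - 2 * mvn_density \<mu> (u + v) m"
  shows "integrated_L2_loss (mvn_density 0 u) \<mu> (mvn_density m v) = ennreal l" and "0 \<le> l"
proof -
  have "has_bochner_integral lborel
      (\<lambda>y. (mvn_density \<mu> u y * mvn_density \<mu> u y + mvn_density m v y * mvn_density m v y)
           - 2 * (mvn_density \<mu> u y * mvn_density m v y))
      ((mvn_density \<mu> (u + u) \<mu> + mvn_density m (v + v) m) - 2 * mvn_density \<mu> (u + v) m)"
    using assms by (intro has_bochner_integral_diff has_bochner_integral_add
        has_bochner_integral_mult_right mvn_convolution)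
  moreover have "(\<lambda>y. (mvn_density \<mu> u y * mvn_density \<mu> u y + mvn_density m v y * mvn_density m v y)
           - 2 * (mvn_density \<mu> u y * mvn_density m v y))
      = (\<lambda>y. (mvn_density \<mu> u y - mvn_density m v y)\<^sup>2)"
    by (simp add: power2_eq_square algebra_simps fun_eq_iff)
  ultimately have h: "has_bochner_integral lborel
      (\<lambda>y. (mvn_density 0 u (y - \<mu>) - mvn_density m v y)\<^sup>2) l"
    by (simp only: l_def mvn_density_self[of \<mu>] mvn_density_self[of m "v + v"] mult_2 mvn_density_shift)
  then have "integrable lborel (\<lambda>y. (mvn_density 0 u (y - \<mu>) - mvn_density m v y)\<^sup>2)"
    and "(LINT y|lborel. (mvn_density 0 u (y - \<mu>) - mvn_density m v y)\<^sup>2) = l"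
    by (auto simp: has_bochner_integral_iff)
  then show "integrated_L2_loss (mvn_density 0 u) \<mu> (mvn_density m v) = ennreal l" "0 \<le> l"
    unfolding integrated_L2_loss_def by (auto simp: nn_integral_eq_integral)
qed

text \<open>As a function of the squared distance \<open>t\<close> from \<open>\<mu>\<close>, the bump \<open>exp (- t / (2 * w))\<close> is convex, hence
  lies above its tangent at the squared distance of \<open>x\<close>. The slope of that tangent is
  again proportional to the bump at \<open>x\<close>.\<close>

lemma mvn_density_tangent:
  fixes \<mu> d x :: "real^'n"
  assumes "w > 0"
  shows "mvn_density \<mu> w x * (((norm (x - \<mu>))\<^sup>2 - (norm (d - \<mu>))\<^sup>2) / (2 * w))
       \<le> mvn_density \<mu> w d - mvn_density \<mu> w x"
proof -
  have tangent: "exp (- t) * (t - s) \<le> exp (- s) - exp (- t)" for s t :: real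
  proof -
    have "exp (- t) * (1 + (t - s)) \<le> exp (- t) * exp (t - s)"
      by (intro mult_left_mono exp_ge_add_one_self) auto
    then show ?thesis by (simp add: exp_add[symmetric] algebra_simps)
  qed
  have "exp (- ((norm (x - \<mu>))\<^sup>2 / (2 * w)))
          * ((norm (x - \<mu>))\<^sup>2 / (2 * w) - (norm (d - \<mu>))\<^sup>2 / (2 * w)) / sqrt (2 * pi * w) ^ CARD('n)
      \<le> (exp (- ((norm (d - \<mu>))\<^sup>2 / (2 * w))) - exp (- ((norm (x - \<mu>))\<^sup>2 / (2 * w))))
          / sqrt (2 * pi * w) ^ CARD('n)"
    using assms by (intro divide_right_mono tangent) auto
  then show ?thesis
    by (simp add: mvn_density_def diff_divide_distrib)
qed

lemma mvn_density_mult_same_mean: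
  fixes \<mu> x :: "real^'n"
  assumes "s > 0" "w > 0"
  shows "mvn_density \<mu> s x * mvn_density \<mu> w x
       = mvn_density (0 :: real^'n) (s + w) 0 * mvn_density \<mu> (s * w / (s + w)) x"
proof -
  have "(w / (s + w)) *\<^sub>R \<mu> + (s / (s + w)) *\<^sub>R \<mu> = \<mu>"
    using assms by (simp add: scaleR_left_distrib[symmetric] add_divide_distrib[symmetric] add.commute)
  then show ?thesis
    using mvn_density_mult[OF assms, of \<mu> x \<mu>] by (simp only: mvn_density_self[of \<mu> "s + w"])
qed


section \<open>Transfer of domination from point to density estimation\<close>

lemma integrable_mvn_density_estimate:
  fixes \<delta> :: "real^'n \<Rightarrow> real^'n"
  assumes "s > 0" "w > 0" and [measurable]: "\<delta> \<in> borel_measurable borel"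
  shows "integrable (mvn_measure \<mu> s) (\<lambda>x. mvn_density \<theta> w (\<delta> x))"
proof -
  interpret prob_space "mvn_measure \<mu> s" using assms(1) by (rule prob_space_mvn_measure)
  show ?thesis
    using assms by (intro integrable_const_bound[where B = "mvn_density (0 :: real^'n) w 0"])
      (auto simp: mvn_density_nonneg mvn_density_le_self)
qed

text \<open>The tangent inequality, weighted by the density of \<open>X\<close>, contains the product
  \<open>mvn_density \<mu> s x * mvn_density \<mu> w x\<close>. This is a constant times the density of variance
  \<open>\<tau> = s * w / (s + w)\<close>, so integrating the tangent inequality under variance \<open>s\<close> produces the
  difference of the quadratic risks under variance \<open>\<tau>\<close>. The tangent
  has to be taken at the identity estimate \<open>x\<close>, because there its slope is a Gaussian in the
  observation.\<close>

lemma gaussian_gain_ge_quadratic_gain: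
  fixes \<delta> :: "real^'n \<Rightarrow> real^'n"
  assumes s: "s > 0" and w: "w > 0" and [measurable]: "\<delta> \<in> borel_measurable borel"
  defines "\<tau> \<equiv> s * w / (s + w)"
  assumes int: "integrable (mvn_measure \<mu> \<tau>) (\<lambda>x. (norm (\<delta> x - \<mu>))\<^sup>2)"
  shows "mvn_density (0 :: real^'n) (s + w) 0 / (2 * w)
           * ((LINT x|mvn_measure \<mu> \<tau>. (norm (x - \<mu>))\<^sup>2)
              - (LINT x|mvn_measure \<mu> \<tau>. (norm (\<delta> x - \<mu>))\<^sup>2))
       \<le> (LINT x|mvn_measure \<mu> s. mvn_density \<mu> w (\<delta> x))
         - (LINT x|mvn_measure \<mu> s. mvn_density \<mu> w x)"
proof -
  let ?c = "mvn_density (0 :: real^'n) (s + w) 0 / (2 * w)"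
  have \<tau>: "\<tau> > 0" using s w by (simp add: \<tau>_def)
  define f where "f x = ?c * ((norm (x - \<mu>))\<^sup>2 - (norm (\<delta> x - \<mu>))\<^sup>2)" for x
  define g where "g x = mvn_density \<mu> w (\<delta> x) - mvn_density \<mu> w x" for x
  have [measurable]: "f \<in> borel_measurable borel" "g \<in> borel_measurable borel"
    unfolding f_def g_def by measurable
  have fi: "integrable (mvn_measure \<mu> \<tau>) f"
    unfolding f_def using int integrable_square_mvn_measure[OF \<tau>, of \<mu>] by auto
  have gi: "integrable (mvn_measure \<mu> s) g"
    unfolding g_def using s w by (intro Bochner_Integration.integrable_diff integrable_mvn_density_estimate) auto
  have "mvn_density \<mu> \<tau> x * f x \<le> mvn_density \<mu> s x * g x" for x
  proof -
    have "mvn_density \<mu> \<tau> x * f x = mvn_density \<mu> s x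
        * (mvn_density \<mu> w x * (((norm (x - \<mu>))\<^sup>2 - (norm (\<delta> x - \<mu>))\<^sup>2) / (2 * w)))"
      using mvn_density_mult_same_mean[OF s w, of \<mu> x] by (simp add: f_def \<tau>_def)
    also have "\<dots> \<le> mvn_density \<mu> s x * g x"
      unfolding g_def using s w by (intro mult_left_mono mvn_density_tangent mvn_density_nonneg)
    finally show ?thesis .
  qed
  then have "integral\<^sup>L (mvn_measure \<mu> \<tau>) f \<le> integral\<^sup>L (mvn_measure \<mu> s) g"
    using fi gi s \<tau> by (simp add: integral_mvn_measure integrable_mvn_measure integral_mono)
  moreover have "integral\<^sup>L (mvn_measure \<mu> \<tau>) f = ?c
           * ((LINT x|mvn_measure \<mu> \<tau>. (norm (x - \<mu>))\<^sup>2)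
              - (LINT x|mvn_measure \<mu> \<tau>. (norm (\<delta> x - \<mu>))\<^sup>2))"
    unfolding f_def using int integrable_square_mvn_measure[OF \<tau>, of \<mu>] by simp
  moreover have "integral\<^sup>L (mvn_measure \<mu> s) g
      = (LINT x|mvn_measure \<mu> s. mvn_density \<mu> w (\<delta> x)) - (LINT x|mvn_measure \<mu> s. mvn_density \<mu> w x)"
    unfolding g_def using s w
    by (intro Bochner_Integration.integral_diff integrable_mvn_density_estimate) auto
  ultimately show ?thesis by simp
qed

lemma mvn_density_in_density_estimators:
  fixes \<delta> :: "real^'n \<Rightarrow> real^'n"
  assumes "v > 0" and [measurable]: "\<delta> \<in> borel_measurable borel"
  shows "(\<lambda>x. mvn_density (\<delta> x) v) \<in> density_estimators"
  using assms by (auto simp: density_estimators_def nn_integral_mvn_density mvn_density_nonneg)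

lemma L2_risk_mvn_density:
  fixes \<delta> :: "real^'n \<Rightarrow> real^'n" and \<mu> :: "real^'n"
  assumes s: "s > 0" and u: "u > 0" and v: "v > 0" and \<delta>: "\<delta> \<in> borel_measurable borel"
  defines "r \<equiv> mvn_density 0 (2 * u) (0 :: real^'n) + mvn_density 0 (2 * v) (0 :: real^'n)
      - 2 * (LINT x|mvn_measure \<mu> s. mvn_density \<mu> (u + v) (\<delta> x))"
  shows "risk (\<lambda>\<mu>. mvn_measure \<mu> s) (integrated_L2_loss (mvn_density 0 u)) \<mu>
      (\<lambda>x. mvn_density (\<delta> x) v) = ennreal r" and "0 \<le> r"
proof -
  interpret prob_space "mvn_measure \<mu> s" using s by (rule prob_space_mvn_measure)
  let ?l = "\<lambda>x. mvn_density 0 (2 * u) (0 :: real^'n) + mvn_density 0 (2 * v) (0 :: real^'n)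
      - 2 * mvn_density \<mu> (u + v) (\<delta> x)"
  have i: "integrable (mvn_measure \<mu> s) (\<lambda>x. mvn_density \<mu> (u + v) (\<delta> x))"
    using s u v \<delta> by (intro integrable_mvn_density_estimate) auto
  then have "integrable (mvn_measure \<mu> s) ?l" and r: "(LINT x|mvn_measure \<mu> s. ?l x) = r"
    by (auto simp: r_def prob_space[simplified])
  then show "risk (\<lambda>\<mu>. mvn_measure \<mu> s) (integrated_L2_loss (mvn_density 0 u)) \<mu>
      (\<lambda>x. mvn_density (\<delta> x) v) = ennreal r"
    unfolding risk_def L2_loss_mvn_density(1)[OF u v] r[symmetric]
    using L2_loss_mvn_density(2)[OF u v] by (intro nn_integral_eq_integral) auto
  show "0 \<le> r" unfolding r[symmetric]
    using L2_loss_mvn_density(2)[OF u v] by (intro Bochner_Integration.integral_nonneg) auto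
qed

text \<open>The identity has finite quadratic risk, so an estimator that dominates it has as well, and all
  risks may be compared as real numbers. The \<open>L\<^sub>2\<close> gain \<open>b\<close> is then at least a positive multiple of
  the quadratic gain \<open>a\<close>, and strictness is inherited at the same parameter. The plug-in variance \<open>v\<close>
  is arbitrary: it enters only through the variance of \<open>Z\<close>.\<close>

theorem dominates_density_if_dominates_point:
  fixes \<delta> :: "real^'n \<Rightarrow> real^'n"
  assumes s: "s > 0" and u: "u > 0" and v: "v > 0"
  assumes dom: "dominates point_estimators (\<lambda>\<mu>. mvn_measure \<mu> (s * (u + v) / (s + (u + v))))
                  squared_error_loss \<delta> (\<lambda>z. z)"
  shows "dominates density_estimators (\<lambda>\<mu>. mvn_measure \<mu> s)
           (integrated_L2_loss (mvn_density 0 u)) (\<lambda>x. mvn_density (\<delta> x) v) (\<lambda>x. mvn_density x v)"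
proof -
  let ?w = "u + v"
  let ?c = "mvn_density (0 :: real^'n) (s + ?w) 0 / (2 * ?w)"
  define \<tau> where "\<tau> = s * ?w / (s + ?w)"
  have w: "?w > 0" and \<tau>: "\<tau> > 0" using s u v by (auto simp: \<tau>_def)
  have c: "?c > 0" using s w by (simp add: mvn_density_pos)
  note dom = dom[folded \<tau>_def, unfolded dominates_def]
  have \<delta>[measurable]: "\<delta> \<in> borel_measurable borel" using dom by (simp add: point_estimators_def)
  let ?P = "\<lambda>\<mu>. mvn_measure \<mu> \<tau>"
  let ?Q = "\<lambda>\<mu>. mvn_measure \<mu> s"
  have id: "risk ?P squared_error_loss \<mu> (\<lambda>z. z) = ennreal (LINT x|?P \<mu>. (norm (x - \<mu>))\<^sup>2)" for \<mu> :: "real^'n"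
    using integrable_square_mvn_measure[OF \<tau>, of \<mu>]
    by (simp add: risk_def squared_error_loss_def nn_integral_eq_integral)
  have int: "integrable (?P \<mu>) (\<lambda>x. (norm (\<delta> x - \<mu>))\<^sup>2)" for \<mu>
  proof (rule integrableI_bounded)
    have "(\<integral>\<^sup>+ x. ennreal (norm ((norm (\<delta> x - \<mu>))\<^sup>2)) \<partial>?P \<mu>) = risk ?P squared_error_loss \<mu> \<delta>"
      by (simp add: risk_def squared_error_loss_def)
    also have "\<dots> \<le> risk ?P squared_error_loss \<mu> (\<lambda>z. z)" using dom by blast
    also have "\<dots> < \<infinity>" by (simp add: id)
    finally show "(\<integral>\<^sup>+ x. ennreal (norm ((norm (\<delta> x - \<mu>))\<^sup>2)) \<partial>?P \<mu>) < \<infinity>" .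
  qed measurable
  then have risk\<delta>: "risk ?P squared_error_loss \<mu> \<delta> = ennreal (LINT x|?P \<mu>. (norm (\<delta> x - \<mu>))\<^sup>2)" for \<mu>
    by (simp add: risk_def squared_error_loss_def nn_integral_eq_integral)
  define a where "a \<mu> = (LINT x|?P \<mu>. (norm (x - \<mu>))\<^sup>2)
      - (LINT x|?P \<mu>. (norm (\<delta> x - \<mu>))\<^sup>2)" for \<mu>
  define b where "b \<mu> = (LINT x|?Q \<mu>. mvn_density \<mu> ?w (\<delta> x))
      - (LINT x|?Q \<mu>. mvn_density \<mu> ?w x)" for \<mu>
  have gain: "?c * a \<mu> \<le> b \<mu>" for \<mu>
    using gaussian_gain_ge_quadratic_gain[OF s w \<delta>] int unfolding a_def b_def \<tau>_def by blast
  have "0 \<le> a \<mu>" for \<mu>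
    using dom by (auto simp: a_def id risk\<delta> ennreal_le_iff Bochner_Integration.integral_nonneg)
  then have b_nonneg: "0 \<le> b \<mu>" for \<mu>
    using gain[of \<mu>] c by (meson mult_nonneg_nonneg less_imp_le order_trans)
  obtain \<mu>0 where "0 < a \<mu>0"
    using dom by (auto simp: a_def id risk\<delta> ennreal_less_iff Bochner_Integration.integral_nonneg)
  then have b_pos: "0 < b \<mu>0"
    using gain[of \<mu>0] c by (meson mult_pos_pos less_le_trans)
  note L2 = L2_risk_mvn_density[OF s u v]
  show ?thesis
    unfolding dominates_def
  proof (intro conjI allI exI)
    show "risk ?Q (integrated_L2_loss (mvn_density 0 u)) \<mu> (\<lambda>x. mvn_density (\<delta> x) v)
        \<le> risk ?Q (integrated_L2_loss (mvn_density 0 u)) \<mu> (\<lambda>x. mvn_density x v)" for \<mu>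
      using b_nonneg[of \<mu>] L2[OF \<delta>, of \<mu>] L2[of "\<lambda>x. x" \<mu>] by (simp add: b_def ennreal_le_iff)
    show "risk ?Q (integrated_L2_loss (mvn_density 0 u)) \<mu>0 (\<lambda>x. mvn_density (\<delta> x) v)
        < risk ?Q (integrated_L2_loss (mvn_density 0 u)) \<mu>0 (\<lambda>x. mvn_density x v)"
      using b_pos L2[OF \<delta>, of \<mu>0] L2[of "\<lambda>x. x" \<mu>0] by (simp add: b_def ennreal_less_iff)
  qed (use v \<delta> in \<open>auto intro!: mvn_density_in_density_estimators\<close>)
qed

section \<open>Stein's phenomenon\<close>

text \<open>Lebesgue measure is invariant under translation, so \<open>F (z + e) - F z\<close> integrates to \<open>0\<close>. By the
  fundamental theorem of calculus this difference is the average of \<open>F'\<close> along the segment from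
  \<open>z\<close> to \<open>z + e\<close>; exchanging the integrals and translating once more turns its integral into that of
  \<open>F'\<close>. This is integration by parts without splitting the space into coordinates.\<close>

lemma integral_directional_derivative_eq_0:
  fixes F F' :: "'a::euclidean_space \<Rightarrow> real"
  assumes F: "integrable lborel F" and F': "integrable lborel F'"
    and cont: "continuous_on UNIV F'"
    and deriv: "\<And>z. ((\<lambda>t. F (z + t *\<^sub>R e)) has_real_derivative F' z) (at 0)"
  shows "(LINT z|lborel. F' z) = 0"
proof -
  have transl: "integrable lborel (\<lambda>z. G (z + c)) \<and> (LINT z|lborel. G (z + c)) = (LINT z|lborel. G z)"
    if "integrable lborel G" for G :: "'a \<Rightarrow> real" and c
  proof -
    have [measurable]: "G \<in> borel_measurable borel" using that by auto
    have "integrable (distr lborel borel ((+) c)) G" using that by (simp add: lborel_distr_plus)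
    moreover have "integral\<^sup>L (distr lborel borel ((+) c)) G = (LINT z|lborel. G z)"
      by (simp add: lborel_distr_plus)
    ultimately show ?thesis
      by (simp add: integrable_distr_eq integral_distr add.commute)
  qed
  have [measurable]: "F' \<in> borel_measurable borel"
    using cont by (rule borel_measurable_continuous_onI)
  define H where "H t z = indicator {0..1} t * F' (z + t *\<^sub>R e)" for t :: real and z
  have H_abs: "norm (H t z) = indicator {0..1} t * \<bar>F' (z + t *\<^sub>R e)\<bar>" for t z
    by (simp add: H_def abs_mult)
  have FTC: "(LINT t|lborel. H t z) = F (z + e) - F z" for z
  proof -
    have "((\<lambda>t. F (z + t *\<^sub>R e)) has_real_derivative F' (z + t *\<^sub>R e)) (at t)" for t
      using deriv[of "z + t *\<^sub>R e"] DERIV_shift[of "\<lambda>t. F (z + t *\<^sub>R e)" _ 0 t]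
      by (simp add: algebra_simps)
    then have d: "((\<lambda>t. F (z + t *\<^sub>R e)) has_vector_derivative F' (z + t *\<^sub>R e)) (at t within {0..1})" for t
      by (simp add: has_real_derivative_iff_has_vector_derivative has_vector_derivative_at_within)
    have "continuous_on {0..1} (\<lambda>t. F' (z + t *\<^sub>R e))"
      by (intro continuous_on_compose2[OF cont] continuous_intros) auto
    from integral_FTC_atLeastAtMost[OF _ d this]
    show ?thesis by (simp add: H_def)
  qed
  have "integrable (lborel \<Otimes>\<^sub>M lborel) (\<lambda>(t, z). H t z)"
  proof (rule lborel_pair.Fubini_integrable)
    show "(\<lambda>(t, z). H t z) \<in> borel_measurable (lborel \<Otimes>\<^sub>M lborel)"
      unfolding H_def by measurable
    have "(\<lambda>t. LINT z|lborel. norm (H t z)) = (\<lambda>t. indicator {0..1} t * (LINT z|lborel. \<bar>F' z\<bar>))"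
      unfolding H_abs using transl[OF integrable_abs[OF F']] by simp
    then show "integrable lborel (\<lambda>t. LINT z|lborel. norm (case (t, z) of (t, z) \<Rightarrow> H t z))"
      by simp
    show "AE t in lborel. integrable lborel (\<lambda>z. case (t, z) of (t, z) \<Rightarrow> H t z)"
      using transl[OF F'] by (simp add: H_def)
  qed
  from lborel_pair.Fubini_integral[OF this]
  have "(LINT z|lborel. F (z + e) - F z) = (LINT t|lborel. LINT z|lborel. H t z)"
    by (simp add: FTC)
  also have "\<dots> = (LINT t|lborel. indicator {0..1} (t::real) * (LINT z|lborel. F' z))"
    using transl[OF F'] by (simp add: H_def)
  also have "\<dots> = (LINT z|lborel. F' z)" by simp
  finally show ?thesis
    using transl[OF F, of e] F by simp
qed

lemma power2_norm_line:
  fixes z e :: "'a::real_inner"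
  shows "(norm (z + t *\<^sub>R e))\<^sup>2 = (norm z)\<^sup>2 + 2 * t * (z \<bullet> e) + t\<^sup>2 * (norm e)\<^sup>2"
  unfolding power2_norm_eq_inner power2_eq_square[of t]
  by (simp add: inner_add inner_commute[of e z] algebra_simps del: dot_square_norm)

lemma mvn_density_directional_derivative:
  fixes \<mu> z e :: "real^'n"
  assumes "v > 0"
  shows "((\<lambda>t. mvn_density \<mu> v (z + t *\<^sub>R e)) has_real_derivative
           - ((z - \<mu>) \<bullet> e / v) * mvn_density \<mu> v z) (at 0)"
proof -
  let ?N = "sqrt (2 * pi * v) ^ CARD('n)"
  have N: "?N \<noteq> 0" using assms by simp
  have sq: "(norm (z + t *\<^sub>R e - \<mu>))\<^sup>2
      = (norm (z - \<mu>))\<^sup>2 + 2 * t * ((z - \<mu>) \<bullet> e) + t\<^sup>2 * (norm e)\<^sup>2" for t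
    using power2_norm_line[of "z - \<mu>" t e] by (simp add: algebra_simps)
  have "((\<lambda>t. exp (- ((norm (z - \<mu>))\<^sup>2 + 2 * t * ((z - \<mu>) \<bullet> e) + t\<^sup>2 * (norm e)\<^sup>2) / (2 * v)) / ?N)
      has_real_derivative exp (- (norm (z - \<mu>))\<^sup>2 / (2 * v)) * (- (2 * ((z - \<mu>) \<bullet> e)) / (2 * v)) / ?N) (at 0)"
    using N assms by (auto intro!: derivative_eq_intros)
  then show ?thesis
    by (simp add: mvn_density_def sq mult.commute)
qed

lemma integrable_mult_bounded:
  fixes f g :: "'a \<Rightarrow> real"
  assumes "integrable M g" "f \<in> borel_measurable M" "\<And>z. \<bar>f z\<bar> \<le> B"
  shows "integrable M (\<lambda>z. g z * f z)"
proof (rule Bochner_Integration.integrable_bound)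
  show "integrable M (\<lambda>z. B * g z)" using assms by simp
  show "AE z in M. norm (g z * f z) \<le> norm (B * g z)"
  proof (rule AE_I2)
    fix z
    have "\<bar>f z\<bar> \<le> \<bar>B\<bar>" using assms(3)[of z] by linarith
    then show "norm (g z * f z) \<le> norm (B * g z)"
      by (simp add: abs_mult mult.commute mult_right_mono)
  qed
qed (use assms in auto)

lemma norm_le_one_plus_square: "norm z \<le> 1 + (norm z)\<^sup>2"
  using sum_squares_bound[of 1 "norm z"] norm_ge_zero[of z] unfolding one_power2 by linarith

text \<open>Stein's identity, in one direction \<open>e\<close>: the derivative along \<open>e\<close> of the product of \<open>f\<close> and
  the Gaussian density is the density times \<open>f' z - ((z - \<mu>) \<bullet> e) * f z / s\<close>, and it integrates to \<open>0\<close>. Boundedness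
  of \<open>f\<close> and \<open>f'\<close> makes every integral involved finite.\<close>

lemma stein_identity:
  fixes f f' :: "real^'n \<Rightarrow> real" and \<mu> e :: "real^'n"
  assumes s: "s > 0"
    and cont: "continuous_on UNIV f" "continuous_on UNIV f'"
    and bdd: "\<And>z. \<bar>f z\<bar> \<le> B" "\<And>z. \<bar>f' z\<bar> \<le> B'"
    and deriv: "\<And>z. ((\<lambda>t. f (z + t *\<^sub>R e)) has_real_derivative f' z) (at 0)"
  shows "(LINT z|mvn_measure \<mu> s. ((z - \<mu>) \<bullet> e) * f z) = s * (LINT z|mvn_measure \<mu> s. f' z)"
    and "integrable (mvn_measure \<mu> s) (\<lambda>z. ((z - \<mu>) \<bullet> e) * f z)"
    and "integrable (mvn_measure \<mu> s) f'"
proof -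
  interpret prob_space "mvn_measure \<mu> s" using s by (rule prob_space_mvn_measure)
  note [measurable] = cont[THEN borel_measurable_continuous_onI]
  have "integrable (mvn_measure \<mu> s) (\<lambda>z. (z - \<mu>) \<bullet> e)"
  proof (rule Bochner_Integration.integrable_bound)
    show "integrable (mvn_measure \<mu> s) (\<lambda>z. (1 + (norm (z - \<mu>))\<^sup>2) * norm e)"
      using integrable_square_mvn_measure[OF s, of \<mu>] by auto
    show "AE z in mvn_measure \<mu> s. norm ((z - \<mu>) \<bullet> e) \<le> norm ((1 + (norm (z - \<mu>))\<^sup>2) * norm e)"
    proof (rule AE_I2)
      fix z
      have "\<bar>(z - \<mu>) \<bullet> e\<bar> \<le> norm (z - \<mu>) * norm e" by (rule Cauchy_Schwarz_ineq2)
      also have "norm (z - \<mu>) \<le> 1 + (norm (z - \<mu>))\<^sup>2"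
        by (rule norm_le_one_plus_square)
      finally show "norm ((z - \<mu>) \<bullet> e) \<le> norm ((1 + (norm (z - \<mu>))\<^sup>2) * norm e)"
        by (simp add: abs_mult mult_right_mono)
    qed
  qed measurable
  then show i1: "integrable (mvn_measure \<mu> s) (\<lambda>z. ((z - \<mu>) \<bullet> e) * f z)"
    by (rule integrable_mult_bounded) (use bdd in auto)
  show i2: "integrable (mvn_measure \<mu> s) f'"
    by (rule integrable_const_bound[where B = B']) (use bdd in auto)
  have i3: "integrable (mvn_measure \<mu> s) f"
    by (rule integrable_const_bound[where B = B]) (use bdd in auto)
  let ?F' = "\<lambda>z. mvn_density \<mu> s z * (f' z - ((z - \<mu>) \<bullet> e) * f z / s)"
  have i: "integrable (mvn_measure \<mu> s) (\<lambda>z. f' z - ((z - \<mu>) \<bullet> e) * f z / s)"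
    using i1 i2 by simp
  have "(LINT z|lborel. ?F' z) = 0"
  proof (rule integral_directional_derivative_eq_0)
    show "integrable lborel (\<lambda>z. mvn_density \<mu> s z * f z)" "integrable lborel ?F'"
      using i i3 s by (simp_all add: integrable_mvn_measure)
    show "continuous_on UNIV ?F'"
      unfolding mvn_density_def using s cont by (intro continuous_intros) auto
    show "((\<lambda>t. mvn_density \<mu> s (z + t *\<^sub>R e) * f (z + t *\<^sub>R e)) has_real_derivative ?F' z) (at 0)" for z
      using DERIV_mult[OF mvn_density_directional_derivative[OF s] deriv, of \<mu> z]
      by (simp add: algebra_simps)
  qed
  then have "(LINT z|mvn_measure \<mu> s. f' z - ((z - \<mu>) \<bullet> e) * f z / s) = 0"
    using s by (simp add: integral_mvn_measure)
  then show "(LINT z|mvn_measure \<mu> s. ((z - \<mu>) \<bullet> e) * f z) = s * (LINT z|mvn_measure \<mu> s. f' z)"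
    using i1 i2 s by (simp add: field_simps)
qed

lemma shrinkage_direction_derivative:
  fixes z e :: "'a::real_inner"
  shows "((\<lambda>t. ((z + t *\<^sub>R e) \<bullet> e) / (1 + (norm (z + t *\<^sub>R e))\<^sup>2)) has_real_derivative
     (e \<bullet> e) / (1 + (norm z)\<^sup>2) - 2 * (z \<bullet> e)\<^sup>2 / (1 + (norm z)\<^sup>2)\<^sup>2) (at 0)"
proof -
  have pos: "1 + (norm z)\<^sup>2 \<noteq> 0" by (smt (verit) zero_le_power2)
  define k where "k = 1 + (norm z)\<^sup>2"
  have "((\<lambda>t. (z \<bullet> e + t * (e \<bullet> e)) / (k + 2 * t * (z \<bullet> e) + t\<^sup>2 * (norm e)\<^sup>2))
     has_real_derivative ((e \<bullet> e) * k - (z \<bullet> e) * (2 * (z \<bullet> e))) / (k * k)) (at 0)"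
    using pos by (auto intro!: derivative_eq_intros simp: k_def[symmetric])
  moreover have "((e \<bullet> e) * k - (z \<bullet> e) * (2 * (z \<bullet> e))) / (k * k) = (e \<bullet> e) / k - 2 * (z \<bullet> e)\<^sup>2 / k\<^sup>2"
    using pos by (simp add: k_def[symmetric] diff_divide_distrib power2_eq_square)
  ultimately show ?thesis
    by (simp add: power2_norm_line k_def inner_add_left add.assoc)
qed

text \<open>A bounded perturbation \<open>- a z / (1 + \<parallel>z\<parallel>\<^sup>2)\<close> of the identity, a smooth relative of the
  James--Stein estimator without its singularity at the origin. Stein's identity turns the cross
  term of the expanded quadratic loss into the divergence of the perturbation, so that the
  difference of the risks is the expectation of a function \<open>h\<close> that does not involve \<open>\<mu>\<close>.
  With \<open>k = 1 + \<parallel>z\<parallel>\<^sup>2\<close>, bounding \<open>\<parallel>z\<parallel>\<^sup>2 / k\<^sup>2\<close> by \<open>1 / k\<close> gives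
  \<open>h \<le> (a\<^sup>2 - 2 * a * s * (p - 2)) / k\<close> in dimension \<open>p\<close>. The choice \<open>a = s * (p - 2)\<close> minimises
  this bound, to \<open>- a\<^sup>2 / k\<close>, and \<open>p \<ge> 3\<close> is what makes \<open>a\<close> positive.\<close>

lemma james_stein_gain:
  fixes \<mu> :: "real^'n"
  assumes s: "s > 0" and p: "CARD('n) \<ge> 3"
  defines "a \<equiv> s * (real CARD('n) - 2)"
  defines "\<delta> \<equiv> \<lambda>z :: real^'n. z - (a / (1 + (norm z)\<^sup>2)) *\<^sub>R z"
  shows "integrable (mvn_measure \<mu> s) (\<lambda>z. (norm (\<delta> z - \<mu>))\<^sup>2)"
    and "(LINT z|mvn_measure \<mu> s. (norm (\<delta> z - \<mu>))\<^sup>2) < (LINT z|mvn_measure \<mu> s. (norm (z - \<mu>))\<^sup>2)"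
proof -
  let ?P = "mvn_measure \<mu> s"
  interpret prob_space ?P using s by (rule prob_space_mvn_measure)
  have a: "a > 0" using s p by (simp add: a_def)
  define k where "k z = 1 + (norm z)\<^sup>2" for z :: "real^'n"
  have k: "k z \<ge> 1" "k z > 0" "k z \<noteq> 0" "(norm z)\<^sup>2 \<le> k z" for z
    using zero_le_power2[of "norm z"] unfolding k_def by linarith+
  have [continuous_intros]: "continuous_on UNIV k"
    unfolding k_def by (intro continuous_intros)
  then have [measurable]: "k \<in> borel_measurable borel" by (rule borel_measurable_continuous_onI)
  define f where "f e z = (z \<bullet> e) / k z" for e z :: "real^'n"
  define f' where "f' e z = (e \<bullet> e) / k z - 2 * (z \<bullet> e)\<^sup>2 / (k z)\<^sup>2" for e z :: "real^'n"
  have bound_f: "\<bar>f e z\<bar> \<le> 1" if "e \<in> Basis" for e z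
    using Basis_le_norm[OF that, of z] norm_le_one_plus_square[of z] k[of z]
    by (simp add: f_def k_def abs_mult)
  have bound_f': "\<bar>f' e z\<bar> \<le> 3" if "e \<in> Basis" for e z
  proof -
    have "f' e z = 1 / k z - 2 * (f e z)\<^sup>2"
      using that by (simp add: f'_def f_def power_divide inner_Basis)
    moreover have "0 \<le> 1 / k z" "1 / k z \<le> 1" using k[of z] by auto
    moreover have "0 \<le> (f e z)\<^sup>2" "(f e z)\<^sup>2 \<le> 1"
      using bound_f[OF that, of z] by (auto simp: abs_square_le_1)
    ultimately show ?thesis by linarith
  qed
  have cont: "continuous_on UNIV (f e)" "continuous_on UNIV (f' e)" for e
    unfolding f_def f'_def using k(3) by (auto intro!: continuous_intros)
  have deriv: "((\<lambda>t. f e (z + t *\<^sub>R e)) has_real_derivative f' e z) (at 0)" for e z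
    unfolding f_def f'_def k_def by (rule shrinkage_direction_derivative)
  note stein = stein_identity[OF s cont bound_f bound_f' deriv, where \<mu> = \<mu>]
  define G where "G z = a\<^sup>2 * ((norm z)\<^sup>2 / (k z)\<^sup>2)" for z
  have [measurable]: "G \<in> borel_measurable borel" unfolding G_def by measurable
  have G_int: "integrable ?P G"
  proof (rule integrable_const_bound[where B = "a\<^sup>2"])
    have "0 \<le> (norm z)\<^sup>2 / (k z)\<^sup>2 \<and> (norm z)\<^sup>2 / (k z)\<^sup>2 \<le> 1" for z
    proof -
      have "(norm z)\<^sup>2 \<le> k z * k z" using k[of z] mult_mono[of "(norm z)\<^sup>2" "k z" 1 "k z"] by simp
      then show ?thesis using k[of z] by (simp add: power2_eq_square)
    qed
    then have "norm (G z) \<le> a\<^sup>2" for z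
      unfolding G_def by (simp only: real_norm_def abs_mult abs_of_nonneg abs_power2 mult_left_le zero_le_power2)
    then show "AE z in ?P. norm (G z) \<le> a\<^sup>2" by simp
  qed measurable
  have expand: "(norm (\<delta> z - \<mu>))\<^sup>2
      = (norm (z - \<mu>))\<^sup>2 - 2 * a * (\<Sum>e\<in>Basis. ((z - \<mu>) \<bullet> e) * f e z) + G z" for z
  proof -
    have "\<delta> z - \<mu> = (z - \<mu>) + (- (a / k z)) *\<^sub>R z" by (simp add: \<delta>_def k_def)
    then have "(norm (\<delta> z - \<mu>))\<^sup>2 = (norm (z - \<mu>))\<^sup>2 - 2 * a * (((z - \<mu>) \<bullet> z) / k z) + G z"
      by (simp only: power2_norm_line) (simp add: G_def power_divide)
    also have "((z - \<mu>) \<bullet> z) / k z = (\<Sum>e\<in>Basis. ((z - \<mu>) \<bullet> e) * f e z)"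
      by (subst euclidean_inner) (simp add: f_def sum_divide_distrib)
    finally show ?thesis .
  qed
  define h where "h z = G z - 2 * a * s * (\<Sum>e\<in>Basis. f' e z)" for z
  note sq = integrable_square_mvn_measure[OF s, of \<mu>]
  have h_int: "integrable ?P h"
    unfolding h_def using G_int stein(3) by auto
  show "integrable ?P (\<lambda>z. (norm (\<delta> z - \<mu>))\<^sup>2)"
    unfolding expand using sq G_int stein(2) by auto
  have "(LINT z|?P. (norm (\<delta> z - \<mu>))\<^sup>2)
      = (LINT z|?P. (norm (z - \<mu>))\<^sup>2) - 2 * a * (\<Sum>e\<in>Basis. LINT z|?P. ((z - \<mu>) \<bullet> e) * f e z)
        + integral\<^sup>L ?P G"
    unfolding expand using sq G_int stein(2) by (simp add: Bochner_Integration.integral_sum)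
  also have "(\<Sum>e\<in>Basis. LINT z|?P. ((z - \<mu>) \<bullet> e) * f e z) = s * (\<Sum>e\<in>Basis. integral\<^sup>L ?P (f' e))"
    using stein(1) by (simp add: sum_distrib_left)
  finally have risk: "(LINT z|?P. (norm (\<delta> z - \<mu>))\<^sup>2) = (LINT z|?P. (norm (z - \<mu>))\<^sup>2) + integral\<^sup>L ?P h"
    unfolding h_def using G_int stein(3) by (simp add: Bochner_Integration.integral_sum)
  have "h z < 0" for z
  proof -
    have "(\<Sum>e\<in>Basis. (z \<bullet> e)\<^sup>2) = (norm z)\<^sup>2"
      unfolding power2_norm_eq_inner by (subst euclidean_inner) (simp add: power2_eq_square)
    then have div: "(\<Sum>e\<in>Basis. f' e z) = real CARD('n) / k z - 2 * ((norm z)\<^sup>2 / (k z)\<^sup>2)"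
      by (simp add: f'_def sum_subtractf inner_Basis sum_divide_distrib[symmetric] sum_distrib_left[symmetric])
    have "(norm z)\<^sup>2 / (k z)\<^sup>2 \<le> k z / (k z)\<^sup>2" using k[of z] by (intro divide_right_mono) auto
    then have le: "(norm z)\<^sup>2 / (k z)\<^sup>2 \<le> 1 / k z" using k[of z] by (simp add: power2_eq_square)
    have "h z = (a\<^sup>2 + 4 * a * s) * ((norm z)\<^sup>2 / (k z)\<^sup>2) - 2 * a * (s * real CARD('n)) / k z"
      unfolding h_def G_def div by (simp add: algebra_simps)
    also have "\<dots> \<le> (a\<^sup>2 + 4 * a * s) * (1 / k z) - 2 * a * (s * real CARD('n)) / k z"
      using a s le by (intro diff_right_mono mult_left_mono) auto
    also have "s * real CARD('n) = a + 2 * s" by (simp add: a_def algebra_simps)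
    also have "(a\<^sup>2 + 4 * a * s) * (1 / k z) - 2 * a * (a + 2 * s) / k z
        = ((a\<^sup>2 + 4 * a * s) - 2 * a * (a + 2 * s)) / k z"
      by (simp only: diff_divide_distrib times_divide_eq_right mult_1_right)
    also have "(a\<^sup>2 + 4 * a * s) - 2 * a * (a + 2 * s) = - a\<^sup>2"
      by (simp add: power2_eq_square algebra_simps)
    also have "- a\<^sup>2 / k z < 0" using a k[of z] by simp
    finally show ?thesis .
  qed
  then have "integral\<^sup>L ?P h < integral\<^sup>L ?P (\<lambda>z. 0)"
    using h_int by (intro integral_less_AE_space) (auto simp: emeasure_space_1[simplified])
  then show "(LINT z|?P. (norm (\<delta> z - \<mu>))\<^sup>2) < (LINT z|?P. (norm (z - \<mu>))\<^sup>2)"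
    unfolding risk by simp
qed

theorem identity_inadmissible:
  assumes s: "s > 0" and p: "CARD('n) \<ge> 3"
  shows "inadmissible point_estimators (\<lambda>\<mu> :: real^'n. mvn_measure \<mu> s) squared_error_loss (\<lambda>z. z)"
proof -
  define \<delta> where "\<delta> z = z - (s * (real CARD('n) - 2) / (1 + (norm z)\<^sup>2)) *\<^sub>R z" for z :: "real^'n"
  note js = james_stein_gain[OF s p, folded \<delta>_def]
  have less: "risk (\<lambda>\<mu>. mvn_measure \<mu> s) squared_error_loss \<mu> \<delta>
      < risk (\<lambda>\<mu>. mvn_measure \<mu> s) squared_error_loss \<mu> (\<lambda>z. z)" for \<mu>
    using js[of \<mu>] integrable_square_mvn_measure[OF s, of \<mu>]
    by (simp add: risk_def squared_error_loss_def nn_integral_eq_integral ennreal_less_iff Bochner_Integration.integral_nonneg)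
  have "\<delta> \<in> point_estimators" "(\<lambda>z. z) \<in> (point_estimators :: (real^'n \<Rightarrow> real^'n) set)"
    unfolding point_estimators_def \<delta>_def by measurable
  then show ?thesis
    unfolding inadmissible_def dominates_def using less less_imp_le by blast
qed

section \<open>Inadmissibility of the minimum risk equivariant density estimator\<close>

theorem corollary3p3:
  fixes M :: "real^'n \<Rightarrow> 'w measure"
    and X Y :: "'w \<Rightarrow> real^'n"
    and \<sigma>X \<sigma>Y \<sigma>Z_sq :: real
  assumes "\<sigma>X > 0" and "\<sigma>Y > 0"
    and "\<And>\<mu>. prob_space (M \<mu>)"
    and "\<And>\<mu>. distributed (M \<mu>) lborel X (\<lambda>x. ennreal (mvn_density \<mu> (\<sigma>X\<^sup>2) x))"
    and "\<And>\<mu>. distributed (M \<mu>) lborel Y (\<lambda>y. ennreal (mvn_density \<mu> (\<sigma>Y\<^sup>2) y))"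
    and "\<And>\<mu>. prob_space.indep_var (M \<mu>) borel X borel Y"
    and "\<sigma>Z_sq = (2 * \<sigma>Y\<^sup>2 + \<sigma>X\<^sup>2) * \<sigma>X\<^sup>2 / (2 * (\<sigma>Y\<^sup>2 + \<sigma>X\<^sup>2))"
  shows "(CARD('n) \<ge> 3 \<longrightarrow>
            inadmissible density_estimators (\<lambda>\<mu>. distr (M \<mu>) borel X)
              (integrated_L2_loss (mvn_density 0 (\<sigma>Y\<^sup>2)))
              (\<lambda>x. mvn_density x (\<sigma>X\<^sup>2 + \<sigma>Y\<^sup>2)))
       \<and> (\<forall>\<mu>hat. dominates point_estimators (\<lambda>\<mu>. mvn_measure \<mu> \<sigma>Z_sq)
                   squared_error_loss \<mu>hat (\<lambda>z. z) \<longrightarrow>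
            dominates density_estimators (\<lambda>\<mu>. distr (M \<mu>) borel X)
              (integrated_L2_loss (mvn_density 0 (\<sigma>Y\<^sup>2)))
              (\<lambda>x. mvn_density (\<mu>hat x) (\<sigma>X\<^sup>2 + \<sigma>Y\<^sup>2))
              (\<lambda>x. mvn_density x (\<sigma>X\<^sup>2 + \<sigma>Y\<^sup>2)))"
proof -
  let ?s = "\<sigma>X\<^sup>2" and ?u = "\<sigma>Y\<^sup>2"
  have s: "?s > 0" and u: "?u > 0" and v: "?s + ?u > 0"
    using assms(1,2) by (auto intro: add_pos_pos)
  have "distr (M \<mu>) borel X = mvn_measure \<mu> ?s" for \<mu>
  proof -
    have "distr (M \<mu>) borel X = distr (M \<mu>) lborel X" by (rule distr_cong) auto
    then show ?thesis
      using assms(4)[of \<mu>] by (simp add: mvn_measure_def distributed_distr_eq_density)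
  qed
  then have law: "(\<lambda>\<mu>. distr (M \<mu>) borel X) = (\<lambda>\<mu>. mvn_measure \<mu> ?s)" by blast
  have z: "\<sigma>Z_sq = ?s * (?u + (?s + ?u)) / (?s + (?u + (?s + ?u)))"
    unfolding assms(7) by (simp add: algebra_simps)
  have "\<sigma>Z_sq > 0"
    unfolding z using s u by (intro divide_pos_pos mult_pos_pos add_pos_pos)
  note point = identity_inadmissible[OF this, where 'n = 'n, unfolded inadmissible_def]
  note transfer = dominates_density_if_dominates_point[OF s u v, folded z]
  show ?thesis
    unfolding law inadmissible_def using point transfer by blast
qed

end
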